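(* Let $\mathcal{B}$ be the Borel sets of $[0,1]$, and let $T:[0,1]\to[0,1]$ and a probability measure $\mu$ on $[0,1]$, absolutely continuous with respect to Lebesgue measure, be such that: (i) there are a dense open set $\Omega'\subset[0,1]$ with $\mu(\Omega')=1$ and a finite or countable family $(I_n)$ of closed intervals with disjoint interiors such that, for each $j$, $I_j\cap([0,1]\setminus\Omega')$ consists exactly of the endpoints of $I_j$; (ii) $T|_{\mathring{I}_n}\in\mathcal{C}^1$ and $|(T|_{\mathring{I}_n})'|\ge m>1$ for every $n$, with $m$ independent of $n$; (iii) $T$ is topologically mixing; (iv) for $g(x):=1/|T'(x)|$, the restriction $g|_{\mathring{I}_n}$ is of bounded variation for every $n$; (v) $([0,1],\mathcal{B},T,\mu,BV,\|\cdot\|_{BV})$ fulfills Property $\mathfrak{C}$. Let $\chi:[0,1]\to\mathbb{R}_{\ge0}$ be such that there exist $\widetilde K_1,\widetilde K_2>0$ with, for all $\ell\in\mathbb{R}_{\ge0}$, $$\mathsf{V}\left({}^{\ell}\chi\right)\le\widetilde K_1\cdot\ell\qquad\text{and}\qquad\mathsf{V}\left(\mathbb{1}_{\{\chi>\ell\}}\right)\le\widetilde K_2.$$ Then $([0,1],\mathcal{B},T,\mu,BV,\|\cdot\|_{BV},\chi)$ fulfills Property $\mathfrak{D}$.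
   Context: Bounded variation. For $\varphi:[0,1]\to\mathbb{R}$, $\mathsf{var}(\varphi):=\sup\{\sum_{i=1}^n|\varphi(x_i)-\varphi(x_{i-1})|:\ n\ge1,\ x_i\in[0,1],\ x_0<x_1<\dots<x_n\}$ and $\mathsf{V}(\varphi):=\inf\{\mathsf{var}(\varphi'):\ \varphi'\text{ is a version of }\varphi\}$. $BV$ is the Banach space of functions with $\mathsf{V}(\varphi)<\infty$, with norm $\|\varphi\|_{BV}:=|\varphi|_\infty+\mathsf{V}(\varphi)$. Transfer operator. For a non-singular transformation $T$ of a probability space $(\Omega,\mathcal{A},\mu)$, $\widehat T:\mathcal{L}^1\to\mathcal{L}^1$ is the unique operator with $\int \widehat T f\cdot g\,\mathrm{d}\mu=\int f\cdot g\circ T\,\mathrm{d}\mu$ for all $f\in\mathcal{L}^1$, $g\in\mathcal{L}^\infty$. $|\cdot|_\infty$ is the $\mathcal{L}^\infty$ norm. Spectral gap. A bounded linear operator $U$ on a Banach space has a spectral gap if $U=\lambda P+N$ with $\lambda\in\mathbb{C}$ and $P,N$ bounded linear operators such that $P^2=P$, $\dim \mathrm{Im}(P)=1$, $\rho(N)<|\lambda|$ ($\rho$ = spectral radius), and $PN=NP=0$. Property $\mathfrak{C}$. Let $\mathcal{F}$ be a subset of the measurable functions forming a Banach algebra with respect to a norm $\|\cdot\|$. $(\Omega,\mathcal{A},T,\mu,\mathcal{F},\|\cdot\|)$ has Property $\mathfrak{C}$ if: $\mu$ is a $T$-invariant, mixing probability measure; $\mathcal{F}$ contains the constant functions and $\|f\|\ge|f|_\infty$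 for all $f\in\mathcal{F}$; there is $K_0>0$ with $\|\widehat T f\|\le K_0\|f\|$ for all $f\in\mathcal{F}$; $\widehat T$ has a spectral gap on $\mathcal{F}$ with respect to $\|\cdot\|$. Property $\mathfrak{D}$. Let $\chi:\Omega\to\mathbb{R}_{\ge0}$ be measurable and ${}^{\ell}\chi:=\chi\cdot\mathbb{1}_{\{\chi\le\ell\}}$ for $\ell\ge0$. $(\Omega,\mathcal{A},T,\mu,\mathcal{F},\|\cdot\|,\chi)$ has Property $\mathfrak{D}$ if $(\Omega,\mathcal{A},T,\mu,\mathcal{F},\|\cdot\|)$ has Property $\mathfrak{C}$ and there are $K_1,K_2>0$ such that for all $\ell>0$: $\|{}^{\ell}\chi\|\le K_1\ell$ and $\|\mathbb{1}_{\{\chi>\ell\}}\|\le K_2$. *)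

theory Defs
  imports "HOL-Probability.Probability"
begin

text \<open>
  Function spaces are represented by sets of honest functions, and elements are identified when
  they agree almost everywhere with respect to the measure at hand: equalities between
  elements of a space are equalities almost everywhere.
\<close>

section \<open>Bounded variation\<close>

definition var_on :: "real set \<Rightarrow> (real \<Rightarrow> real) \<Rightarrow> ennreal" where
  "var_on S \<phi> =
     (SUP (n, x) \<in> {(n :: nat, x :: nat \<Rightarrow> real).
          n \<ge> 1 \<and> (\<forall>i\<le>n. x i \<in> S) \<and> strict_mono_on {0..n} x}.
        ennreal (\<Sum>i=1..n. \<bar>\<phi> (x i) - \<phi> (x (i - 1))\<bar>))"

abbreviation var :: "(real \<Rightarrow> real) \<Rightarrow> ennreal" where
  "var \<equiv> var_on {0..1}"

definition ess_var :: "real measure \<Rightarrow> (real \<Rightarrow> real) \<Rightarrow> ennreal" where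
  "ess_var M \<phi> = (INF \<psi> \<in> {\<psi>. AE x in M. \<psi> x = \<phi> x}. var \<psi>)"

definition Linf_norm :: "'a measure \<Rightarrow> ('a \<Rightarrow> real) \<Rightarrow> ennreal" where
  "Linf_norm M f = esssup M (\<lambda>x. ennreal \<bar>f x\<bar>)"

definition Linf_space :: "'a measure \<Rightarrow> ('a \<Rightarrow> real) set" where
  "Linf_space M = {g \<in> borel_measurable M. Linf_norm M g < \<infinity>}"

definition BV_space :: "real measure \<Rightarrow> (real \<Rightarrow> real) set" where
  "BV_space M = {\<phi> \<in> borel_measurable M. ess_var M \<phi> < \<infinity>}"

text \<open>Both summands are finite on \<^term>\<open>BV_space M\<close>.\<close>

definition BV_norm :: "real measure \<Rightarrow> (real \<Rightarrow> real) \<Rightarrow> real" where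
  "BV_norm M \<phi> = enn2real (Linf_norm M \<phi> + ess_var M \<phi>)"


section \<open>Transfer operator\<close>

text \<open>
  The defining property only depends on the class of \<open>f\<close>, so functions agreeing
  almost everywhere have literally the same image.
\<close>

definition transfer_operator :: "'a measure \<Rightarrow> ('a \<Rightarrow> 'a) \<Rightarrow> ('a \<Rightarrow> real) \<Rightarrow> 'a \<Rightarrow> real" where
  "transfer_operator M T f =
     (SOME h. integrable M h \<and>
        (\<forall>g\<in>Linf_space M. (\<integral>x. h x * g x \<partial>M) = (\<integral>x. f x * g (T x) \<partial>M)))"


section \<open>Banach algebras of measurable functions\<close>

text \<open>
  Closure under almost everywhere equality makes \<open>F\<close> a union of classes on which
  \<open>nrm\<close> is well defined.
\<close>

definition banach_function_algebra ::
    "'a measure \<Rightarrow> ('a \<Rightarrow> real) set \<Rightarrow> (('a \<Rightarrow> real) \<Rightarrow> real) \<Rightarrow> bool" where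
  "banach_function_algebra M F nrm \<longleftrightarrow>
     F \<subseteq> borel_measurable M \<and>
     (\<forall>f\<in>F. \<forall>g\<in>borel_measurable M. (AE x in M. f x = g x) \<longrightarrow> g \<in> F \<and> nrm g = nrm f) \<and>
     (\<lambda>x. 0) \<in> F \<and>
     (\<forall>f\<in>F. \<forall>g\<in>F. (\<lambda>x. f x + g x) \<in> F \<and> nrm (\<lambda>x. f x + g x) \<le> nrm f + nrm g) \<and>
     (\<forall>c. \<forall>f\<in>F. (\<lambda>x. c * f x) \<in> F \<and> nrm (\<lambda>x. c * f x) = \<bar>c\<bar> * nrm f) \<and>
     (\<forall>f\<in>F. nrm f \<ge> 0 \<and> (nrm f = 0 \<longleftrightarrow> (AE x in M. f x = 0))) \<and>
     (\<forall>f\<in>F. \<forall>g\<in>F. (\<lambda>x. f x * g x) \<in> F \<and> nrm (\<lambda>x. f x * g x) \<le> nrm f * nrm g) \<and>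
     (\<forall>f. (\<forall>n :: nat. f n \<in> F) \<and>
          (\<forall>\<epsilon>>0. \<exists>n0. \<forall>m\<ge>n0. \<forall>n\<ge>n0. nrm (\<lambda>x. f m x - f n x) < \<epsilon>) \<longrightarrow>
          (\<exists>g\<in>F. (\<lambda>n. nrm (\<lambda>x. f n x - g x)) \<longlonglongrightarrow> 0))"


section \<open>Spectral gap\<close>

text \<open>
  In this section \<open>E\<close> is a complex vector space of functions with norm
  \<open>nrm\<close>, modulo equality almost everywhere.
\<close>

definition bounded_operator ::
    "'a measure \<Rightarrow> ('a \<Rightarrow> complex) set \<Rightarrow> (('a \<Rightarrow> complex) \<Rightarrow> real) \<Rightarrow>
     (('a \<Rightarrow> complex) \<Rightarrow> 'a \<Rightarrow> complex) \<Rightarrow> bool" where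
  "bounded_operator M E nrm A \<longleftrightarrow>
     (\<forall>f\<in>E. A f \<in> E) \<and>
     (\<forall>f\<in>E. \<forall>g\<in>E. AE x in M. A (\<lambda>y. f y + g y) x = A f x + A g x) \<and>
     (\<forall>c. \<forall>f\<in>E. AE x in M. A (\<lambda>y. c * f y) x = c * A f x) \<and>
     (\<exists>C. \<forall>f\<in>E. nrm (A f) \<le> C * nrm f)"

definition op_spectrum ::
    "'a measure \<Rightarrow> ('a \<Rightarrow> complex) set \<Rightarrow> (('a \<Rightarrow> complex) \<Rightarrow> real) \<Rightarrow>
     (('a \<Rightarrow> complex) \<Rightarrow> 'a \<Rightarrow> complex) \<Rightarrow> complex set" where
  "op_spectrum M E nrm A =
     {z. \<not> (\<exists>B. bounded_operator M E nrm B \<and>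
              (\<forall>f\<in>E. AE x in M. B (\<lambda>y. z * f y - A f y) x = f x) \<and>
              (\<forall>f\<in>E. AE x in M. z * B f x - A (B f) x = f x))}"

definition op_spectral_radius ::
    "'a measure \<Rightarrow> ('a \<Rightarrow> complex) set \<Rightarrow> (('a \<Rightarrow> complex) \<Rightarrow> real) \<Rightarrow>
     (('a \<Rightarrow> complex) \<Rightarrow> 'a \<Rightarrow> complex) \<Rightarrow> ennreal" where
  "op_spectral_radius M E nrm A = (SUP z \<in> op_spectrum M E nrm A. ennreal (cmod z))"

text \<open>The last clause on \<open>P\<close> says that its image is spanned by the nonzero class of \<open>P e\<close>.\<close>

definition has_spectral_gap ::
    "'a measure \<Rightarrow> ('a \<Rightarrow> complex) set \<Rightarrow> (('a \<Rightarrow> complex) \<Rightarrow> real) \<Rightarrow>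
     (('a \<Rightarrow> complex) \<Rightarrow> 'a \<Rightarrow> complex) \<Rightarrow> bool" where
  "has_spectral_gap M E nrm U \<longleftrightarrow>
     bounded_operator M E nrm U \<and>
     (\<exists>c P N.
        bounded_operator M E nrm P \<and>
        bounded_operator M E nrm N \<and>
        (\<forall>f\<in>E. AE x in M. U f x = c * P f x + N f x) \<and>
        (\<forall>f\<in>E. AE x in M. P (P f) x = P f x) \<and>
        (\<exists>e\<in>E. \<not> (AE x in M. P e x = 0) \<and>
           (\<forall>f\<in>E. \<exists>d. AE x in M. P f x = d * P e x)) \<and>
        op_spectral_radius M E nrm N < ennreal (cmod c) \<and>
        (\<forall>f\<in>E. AE x in M. P (N f) x = 0) \<and>
        (\<forall>f\<in>E. AE x in M. N (P f) x = 0))"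

text \<open>
  The spaces of interest consist of real functions, whereas the notion of spectral gap involves
  complex scalars; as usual, spectral notions for a real operator refer to its complexification.
  The norm below is the Taylor norm on the complexification of a real Banach space.
\<close>

definition cplx_space :: "('a \<Rightarrow> real) set \<Rightarrow> ('a \<Rightarrow> complex) set" where
  "cplx_space F = {f. (\<lambda>x. Re (f x)) \<in> F \<and> (\<lambda>x. Im (f x)) \<in> F}"

definition cplx_norm :: "(('a \<Rightarrow> real) \<Rightarrow> real) \<Rightarrow> ('a \<Rightarrow> complex) \<Rightarrow> real" where
  "cplx_norm nrm f = (SUP \<theta> :: real. nrm (\<lambda>x. Re (cis \<theta> * f x)))"

definition cplx_op ::
    "(('a \<Rightarrow> real) \<Rightarrow> 'a \<Rightarrow> real) \<Rightarrow> ('a \<Rightarrow> complex) \<Rightarrow> 'a \<Rightarrow> complex" where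
  "cplx_op U f = (\<lambda>x. Complex (U (\<lambda>y. Re (f y)) x) (U (\<lambda>y. Im (f y)) x))"


section \<open>Properties C and D\<close>

definition invariant_measure :: "'a measure \<Rightarrow> ('a \<Rightarrow> 'a) \<Rightarrow> bool" where
  "invariant_measure M T \<longleftrightarrow> T \<in> measurable M M \<and> distr M M T = M"

definition mixing_measure :: "'a measure \<Rightarrow> ('a \<Rightarrow> 'a) \<Rightarrow> bool" where
  "mixing_measure M T \<longleftrightarrow>
     (\<forall>A\<in>sets M. \<forall>B\<in>sets M.
        (\<lambda>n. measure M (A \<inter> ((T ^^ n) -` B \<inter> space M))) \<longlonglongrightarrow> measure M A * measure M B)"

definition property_C ::
    "'a measure \<Rightarrow> ('a \<Rightarrow> 'a) \<Rightarrow> ('a \<Rightarrow> real) set \<Rightarrow> (('a \<Rightarrow> real) \<Rightarrow> real) \<Rightarrow> bool" where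
  "property_C M T F nrm \<longleftrightarrow>
     banach_function_algebra M F nrm \<and>
     prob_space M \<and> invariant_measure M T \<and> mixing_measure M T \<and>
     (\<forall>c. (\<lambda>x. c) \<in> F) \<and>
     (\<forall>f\<in>F. Linf_norm M f \<le> ennreal (nrm f)) \<and>
     (\<exists>K0>0. \<forall>f\<in>F. transfer_operator M T f \<in> F \<and> nrm (transfer_operator M T f) \<le> K0 * nrm f) \<and>
     has_spectral_gap M (cplx_space F) (cplx_norm nrm) (cplx_op (transfer_operator M T))"

definition truncation :: "real \<Rightarrow> ('a \<Rightarrow> real) \<Rightarrow> 'a \<Rightarrow> real" where
  "truncation l chi x = chi x * indicator {y. chi y \<le> l} x"

definition property_D ::
    "'a measure \<Rightarrow> ('a \<Rightarrow> 'a) \<Rightarrow> ('a \<Rightarrow> real) set \<Rightarrow> (('a \<Rightarrow> real) \<Rightarrow> real) \<Rightarrow>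
     ('a \<Rightarrow> real) \<Rightarrow> bool" where
  "property_D M T F nrm chi \<longleftrightarrow>
     chi \<in> borel_measurable M \<and> (\<forall>x\<in>space M. chi x \<ge> 0) \<and>
     property_C M T F nrm \<and>
     (\<exists>K1>0. \<exists>K2>0. \<forall>l>0.
        truncation l chi \<in> F \<and> nrm (truncation l chi) \<le> K1 * l \<and>
        indicator {x. chi x > l} \<in> F \<and> nrm (indicator {x. chi x > l}) \<le> K2)"


section \<open>Topological mixing\<close>

text \<open>No continuity of \<open>T\<close> is required; open means relatively open in \<open>X\<close>.\<close>

definition topologically_mixing_on :: "'a::topological_space set \<Rightarrow> ('a \<Rightarrow> 'a) \<Rightarrow> bool" where
  "topologically_mixing_on X T \<longleftrightarrow>
     (\<forall>U V. openin (top_of_set X) U \<and> openin (top_of_set X) V \<and> U \<noteq> {} \<and> V \<noteq> {} \<longrightarrow>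
        (\<exists>n0. \<forall>n\<ge>n0. (T ^^ n) ` U \<inter> V \<noteq> {}))"

end

theory Submission
  imports Defs
begin

text \<open>Property D is Property C, which is hypothesis \<open>v\<close>, plus two norm bounds.
  The BV norm is a sup norm plus a variation, and the variations are bounded by hypothesis, so only
  sup norms remain. Since \<open>chi\<close> is nonnegative, its truncation at \<open>l\<close>
  takes values in [0, \<open>l\<close>], and an indicator is at most 1. Adding these bounds to
  \<open>K1 * l\<close> and \<open>K2\<close> gives the constants \<open>1 + K1\<close> and
  \<open>1 + K2\<close>. \<open>BV_space_BV_norm_le\<close> does this addition for any
  function.\<close>

lemma BV_space_BV_norm_le:
  assumes "f \<in> borel_measurable M" and "AE x in M. \<bar>f x\<bar> \<le> A" and "ess_var M f \<le> ennreal B"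
    and "A \<ge> 0" "B \<ge> 0"
  shows "f \<in> BV_space M" and "BV_norm M f \<le> A + B"
proof -
  show "f \<in> BV_space M"
    using assms le_less_trans[OF assms(3) ennreal_less_top] by (simp add: BV_space_def)
  have "Linf_norm M f \<le> ennreal A"
    unfolding Linf_norm_def using assms by (intro esssup_I) (auto intro: ennreal_leI)
  \<comment> \<open>\<open>ennreal\<close> sends negative reals to 0 and is additive on nonnegative
    ones; hence the sign conditions on \<open>A\<close> and \<open>B\<close>.\<close>
  with assms have "Linf_norm M f + ess_var M f \<le> ennreal (A + B)"
    by (simp add: add_mono)
  with assms show "BV_norm M f \<le> A + B"
    unfolding BV_norm_def by (simp add: enn2real_leI)
qed

lemma borel_measurable_truncation [measurable]:
  assumes "chi \<in> borel_measurable M"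
  shows "truncation l chi \<in> borel_measurable M"
proof -
  have "truncation l chi = (\<lambda>x. if chi x \<le> l then chi x else 0)"
    by (auto simp: truncation_def fun_eq_iff)
  with assms show ?thesis by simp
qed

theorem proposition1p12:
  fixes T :: "real \<Rightarrow> real" and \<mu> :: "real measure"
    and \<Omega>' :: "real set" and J :: "nat set" and a b :: "nat \<Rightarrow> real" and m :: real
    and chi :: "real \<Rightarrow> real" and K1 K2 :: real
  assumes T_maps: "T ` {0..1} \<subseteq> {0..1}"
    and mu_sets: "sets \<mu> = sets (restrict_space borel {0..1})"
    and mu_prob: "prob_space \<mu>"
    and mu_ac: "absolutely_continuous (restrict_space lborel {0..1}) \<mu>"
    and i_open: "openin (top_of_set {0..1}) \<Omega>'"
    and i_dense: "{0..1} \<subseteq> closure \<Omega>'"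
    and i_full: "emeasure \<mu> \<Omega>' = 1"
    and i_interval: "\<And>j. j \<in> J \<Longrightarrow> a j < b j"
    and i_disjoint: "disjoint_family_on (\<lambda>j. interior {a j..b j}) J"
    and i_endpoints: "\<And>j. j \<in> J \<Longrightarrow> {a j..b j} \<inter> ({0..1} - \<Omega>') = {a j, b j}"
    and ii_diff: "\<And>j x. j \<in> J \<Longrightarrow> x \<in> interior {a j..b j} \<Longrightarrow> T differentiable (at x)"
    and ii_C1: "\<And>j. j \<in> J \<Longrightarrow> continuous_on (interior {a j..b j}) (deriv T)"
    and ii_expanding: "m > 1" "\<And>j x. j \<in> J \<Longrightarrow> x \<in> interior {a j..b j} \<Longrightarrow> \<bar>deriv T x\<bar> \<ge> m"
    and iii: "topologically_mixing_on {0..1} T"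
    and iv: "\<And>j. j \<in> J \<Longrightarrow> var_on (interior {a j..b j}) (\<lambda>x. 1 / \<bar>deriv T x\<bar>) < \<infinity>"
    and v: "property_C \<mu> T (BV_space \<mu>) (BV_norm \<mu>)"
    and chi_meas: "chi \<in> borel_measurable \<mu>"
    and chi_nonneg: "\<And>x. x \<in> {0..1} \<Longrightarrow> chi x \<ge> 0"
    and K_pos: "K1 > 0" "K2 > 0"
    and chi_trunc: "\<And>l. l \<ge> 0 \<Longrightarrow> ess_var \<mu> (truncation l chi) \<le> ennreal (K1 * l)"
    and chi_ind: "\<And>l. l \<ge> 0 \<Longrightarrow> ess_var \<mu> (indicator {x. chi x > l}) \<le> ennreal K2"
  shows "property_D \<mu> T (BV_space \<mu>) (BV_norm \<mu>) chi"
proof -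
  \<comment> \<open>The sign of \<open>chi\<close> is known only on [0,1]; this identity makes that
    enough for statements almost everywhere.\<close>
  have space: "space \<mu> = {0..1}"
    using sets_eq_imp_space_eq[OF mu_sets] by (simp add: space_restrict_space)
  have trunc: "truncation l chi \<in> BV_space \<mu> \<and> BV_norm \<mu> (truncation l chi) \<le> (1 + K1) * l"
    if "l > 0" for l
  proof -
    \<comment> \<open>Where \<open>chi x \<le> l\<close>, nonnegativity gives
      \<open>\<bar>chi x\<bar> \<le> l\<close>; elsewhere the truncation is 0.\<close>
    have "AE x in \<mu>. \<bar>truncation l chi x\<bar> \<le> l"
      using chi_nonneg that by (intro AE_I2) (auto simp: truncation_def space indicator_def)
    \<comment> \<open>Here \<open>A = l\<close> and \<open>B = K1 * l\<close>, so the bound stays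
      linear in \<open>l\<close>.\<close>
    from BV_space_BV_norm_le[OF _ this chi_trunc] show ?thesis
      using chi_meas K_pos that by (simp add: borel_measurable_truncation distrib_right)
  qed
  have ind: "indicator {x. chi x > l} \<in> BV_space \<mu> \<and> BV_norm \<mu> (indicator {x. chi x > l}) \<le> 1 + K2"
    if "l > 0" for l
  proof -
    have meas: "(indicator {x. chi x > l} :: real \<Rightarrow> real) \<in> borel_measurable \<mu>"
      using chi_meas by measurable
    have "AE x in \<mu>. \<bar>indicator {x. chi x > l} x :: real\<bar> \<le> 1"
      by (simp add: indicator_def)
    \<comment> \<open>Here \<open>A = 1\<close> and \<open>B = K2\<close>, so the bound is uniform
      in \<open>l\<close>.\<close>
    from BV_space_BV_norm_le[OF meas this chi_ind] show ?thesis
      using K_pos that by simp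
  qed
  \<comment> \<open>These are the witnesses for the two constants of
    \<open>property_D\<close>.\<close>
  have "1 + K1 > 0" "1 + K2 > 0"
    using K_pos by simp_all
  with trunc ind chi_meas chi_nonneg v show ?thesis
    unfolding property_D_def space by blast
qed

end
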